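(* Let $f$ be a cover. Then a Galois closure of $f$ exists and is unique up to isomorphism. Moreover, for a cover $g$ the following are equivalent: (i) $g$ is a Galois closure of $f$; (ii) $g$ is a least cover with respect to the property that $g$ is Galois and $f\sqsubseteq g$; (iii) $g$ is a least cover with respect to the property $|{\rm Hom}(g,f)|=\deg f$; (iv) $g$ is a minimal cover with respect to the property $|{\rm Hom}(g,f)|=\deg f$.
   Context: Let $\mathbf C$ be a category and $\mathbf D$ a full subcategory of $\mathbf C$. For arrows $f,g$ of $\mathbf C$ with ${\rm cod}\,f={\rm cod}\,g$, ${\rm Hom}(g,f)$ denotes the collection of all arrows $h$ of $\mathbf C$ with $g=f\circ h$. Standing assumptions: (G1) every diagram $B\to A\leftarrow C$ in $\mathbf D$ has a pullback in $\mathbf C$. (G2) (I) pushouts exist in $\mathbf D$; (II) every arrow of $\mathbf D$ is epic; (III) every monic arrow of $\mathbf D$ is an isomorphism whose inverse is an arrow of $\mathbf D$. (G3) for every object $U$ of $\mathbf C$ there is a set $\Sigma(U)$ of arrows $i$ of $\mathbf C$ with ${\rm dom}\,i$ in $\mathbf D$ and ${\rm cod}\,i=U$ such that for every arrow $u$ of $\mathbf C$ with ${\rm dom}\,u$ in $\mathbf D$ and ${\rm cod}\,u=U$ there is exactly one $i\in\Sigma(U)$ with ${\rm Hom}(u,i)\neq\emptyset$. (G4) there is a function $\deg$ from the collection of arrows of $\mathbf C$ whose codomain lies in $\mathbf D$ to the positive integers such that (I) $\deg(g\circ f)=\deg g\cdot\deg f$ whenever $f,g,g\circ f$ all lie in this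 collection; (II) $\deg f=\sum_{i\in\Sigma({\rm dom}\,f)}\deg(f\circ i)$ for every such $f$; (III) if $B\xrightarrow{f}A\xleftarrow{g}C$ is a diagram in $\mathbf D$ with pullback $B\xleftarrow{p}U\xrightarrow{q}C$, then $\deg f=\deg q$ and $\deg g=\deg p$. A cover is an arrow of $\mathbf D$. For a cover $f$, ${\rm Aut}(f)$ is the set of isomorphisms in ${\rm Hom}(f,f)$; $f$ is Galois if $|{\rm Aut}(f)|=\deg f$. Write $f\sqsubseteq g$ if ${\rm cod}\,f={\rm cod}\,g$ and ${\rm Hom}(g,f)\neq\emptyset$. Two covers $f,g$ are isomorphic if $f\sqsubseteq g$ and $g\sqsubseteq f$. A cover $g$ is least with respect to a property $P$ if $g$ has $P$ and $g\sqsubseteq h$ for every cover $h$ with $P$; it is minimal with respect to $P$ if $g$ has $P$ and $g\sqsubseteq h$ for every cover $h$ with $P$ and $h\sqsubseteq g$. A Galois closure of a cover $f$ is a cover $g$ which is minimal with respect to the property "$g$ is Galois and $f\sqsubseteq g$". *)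

theory Defs
  imports Main
begin

text \<open>
  A category is a record of carriers and operations. Composition is a total function, but
  \<open>g \<cdot>\<^bsub>C\<^esub> f\<close> is only meaningful for arrows with \<open>Dom C g = Cod C f\<close>.
\<close>

record ('o, 'a) cat =
  Obj :: "'o set"
  Arr :: "'a set"
  Dom :: "'a \<Rightarrow> 'o"
  Cod :: "'a \<Rightarrow> 'o"
  Ident :: "'o \<Rightarrow> 'a"
  Comp :: "'a \<Rightarrow> 'a \<Rightarrow> 'a"  (infixl "\<cdot>\<index>" 70)

locale category =
  fixes C :: "('o, 'a) cat" (structure)
  assumes Dom_Obj: "f \<in> Arr C \<Longrightarrow> Dom C f \<in> Obj C"
    and Cod_Obj: "f \<in> Arr C \<Longrightarrow> Cod C f \<in> Obj C"
    and Ident_Arr: "A \<in> Obj C \<Longrightarrow> Ident C A \<in> Arr C"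
    and Dom_Ident: "A \<in> Obj C \<Longrightarrow> Dom C (Ident C A) = A"
    and Cod_Ident: "A \<in> Obj C \<Longrightarrow> Cod C (Ident C A) = A"
    and Comp_Arr: "\<lbrakk>f \<in> Arr C; g \<in> Arr C; Dom C g = Cod C f\<rbrakk> \<Longrightarrow> g \<cdot> f \<in> Arr C"
    and Dom_Comp: "\<lbrakk>f \<in> Arr C; g \<in> Arr C; Dom C g = Cod C f\<rbrakk> \<Longrightarrow> Dom C (g \<cdot> f) = Dom C f"
    and Cod_Comp: "\<lbrakk>f \<in> Arr C; g \<in> Arr C; Dom C g = Cod C f\<rbrakk> \<Longrightarrow> Cod C (g \<cdot> f) = Cod C g"
    and Comp_Ident: "f \<in> Arr C \<Longrightarrow> f \<cdot> Ident C (Dom C f) = f"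
    and Ident_Comp: "f \<in> Arr C \<Longrightarrow> Ident C (Cod C f) \<cdot> f = f"
    and Comp_assoc: "\<lbrakk>f \<in> Arr C; g \<in> Arr C; h \<in> Arr C; Dom C g = Cod C f; Dom C h = Cod C g\<rbrakk>
      \<Longrightarrow> (h \<cdot> g) \<cdot> f = h \<cdot> (g \<cdot> f)"

text \<open>A full subcategory is determined by its set of objects.\<close>

definition full_sub :: "('o, 'a) cat \<Rightarrow> 'o set \<Rightarrow> ('o, 'a) cat" where
  "full_sub C S = C\<lparr>Obj := S, Arr := {f \<in> Arr C. Dom C f \<in> S \<and> Cod C f \<in> S}\<rparr>"

lemma (in category) category_full_sub:
  assumes "S \<subseteq> Obj C"
  shows "category (full_sub C S)"
  using assms
  by unfold_locales
    (auto simp: full_sub_def Ident_Arr Dom_Ident Cod_Ident Comp_Arr Dom_Comp Cod_Comp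
      Comp_Ident Ident_Comp Comp_assoc)

definition epic :: "('o, 'a) cat \<Rightarrow> 'a \<Rightarrow> bool" where
  "epic C e \<longleftrightarrow> e \<in> Arr C \<and>
    (\<forall>x\<in>Arr C. \<forall>y\<in>Arr C. Dom C x = Cod C e \<and> Dom C y = Cod C e \<and> Cod C x = Cod C y \<and>
      x \<cdot>\<^bsub>C\<^esub> e = y \<cdot>\<^bsub>C\<^esub> e \<longrightarrow> x = y)"

definition monic :: "('o, 'a) cat \<Rightarrow> 'a \<Rightarrow> bool" where
  "monic C m \<longleftrightarrow> m \<in> Arr C \<and>
    (\<forall>x\<in>Arr C. \<forall>y\<in>Arr C. Cod C x = Dom C m \<and> Cod C y = Dom C m \<and> Dom C x = Dom C y \<and>
      m \<cdot>\<^bsub>C\<^esub> x = m \<cdot>\<^bsub>C\<^esub> y \<longrightarrow> x = y)"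

definition is_iso :: "('o, 'a) cat \<Rightarrow> 'a \<Rightarrow> bool" where
  "is_iso C f \<longleftrightarrow> f \<in> Arr C \<and>
    (\<exists>g\<in>Arr C. Dom C g = Cod C f \<and> Cod C g = Dom C f \<and>
      g \<cdot>\<^bsub>C\<^esub> f = Ident C (Dom C f) \<and> f \<cdot>\<^bsub>C\<^esub> g = Ident C (Cod C f))"

text \<open>\<open>B \<leftarrow>p\<midarrow> U \<midarrow>q\<rightarrow> C\<close> is a pullback of \<open>B \<midarrow>f\<rightarrow> A \<leftarrow>g\<midarrow> C\<close>.\<close>

definition is_pullback :: "('o, 'a) cat \<Rightarrow> 'a \<Rightarrow> 'a \<Rightarrow> 'a \<Rightarrow> 'a \<Rightarrow> bool" where
  "is_pullback C f g p q \<longleftrightarrow>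
    {f, g, p, q} \<subseteq> Arr C \<and> Cod C f = Cod C g \<and> Dom C p = Dom C q \<and>
    Cod C p = Dom C f \<and> Cod C q = Dom C g \<and> f \<cdot>\<^bsub>C\<^esub> p = g \<cdot>\<^bsub>C\<^esub> q \<and>
    (\<forall>x\<in>Arr C. \<forall>y\<in>Arr C. Dom C x = Dom C y \<and> Cod C x = Dom C f \<and> Cod C y = Dom C g \<and>
      f \<cdot>\<^bsub>C\<^esub> x = g \<cdot>\<^bsub>C\<^esub> y \<longrightarrow>
      (\<exists>!u. u \<in> Arr C \<and> Dom C u = Dom C x \<and> Cod C u = Dom C p \<and>
        p \<cdot>\<^bsub>C\<^esub> u = x \<and> q \<cdot>\<^bsub>C\<^esub> u = y))"

text \<open>\<open>B \<midarrow>p\<rightarrow> U \<leftarrow>q\<midarrow> C\<close> is a pushout of \<open>B \<leftarrow>f\<midarrow> A \<midarrow>g\<rightarrow> C\<close>.\<close>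

definition is_pushout :: "('o, 'a) cat \<Rightarrow> 'a \<Rightarrow> 'a \<Rightarrow> 'a \<Rightarrow> 'a \<Rightarrow> bool" where
  "is_pushout C f g p q \<longleftrightarrow>
    {f, g, p, q} \<subseteq> Arr C \<and> Dom C f = Dom C g \<and> Cod C p = Cod C q \<and>
    Dom C p = Cod C f \<and> Dom C q = Cod C g \<and> p \<cdot>\<^bsub>C\<^esub> f = q \<cdot>\<^bsub>C\<^esub> g \<and>
    (\<forall>x\<in>Arr C. \<forall>y\<in>Arr C. Cod C x = Cod C y \<and> Dom C x = Cod C f \<and> Dom C y = Cod C g \<and>
      x \<cdot>\<^bsub>C\<^esub> f = y \<cdot>\<^bsub>C\<^esub> g \<longrightarrow>
      (\<exists>!u. u \<in> Arr C \<and> Dom C u = Cod C p \<and> Cod C u = Cod C x \<and>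
        u \<cdot>\<^bsub>C\<^esub> p = x \<and> u \<cdot>\<^bsub>C\<^esub> q = y))"

text \<open>
  Note the order of the arguments: \<open>Hom C g f\<close> is the set of factorisations of \<open>g\<close> through \<open>f\<close>;
  it is empty unless \<open>f\<close> and \<open>g\<close> have the same codomain.
\<close>

definition Hom :: "('o, 'a) cat \<Rightarrow> 'a \<Rightarrow> 'a \<Rightarrow> 'a set" where
  "Hom C g f = {h \<in> Arr C. Cod C h = Dom C f \<and> g = f \<cdot>\<^bsub>C\<^esub> h}"

text \<open>
  \<open>S\<close> is the set of objects of the full subcategory \<open>\<^bold>D\<close>. Pushouts, epic and monic in (G2) are taken
  in \<open>\<^bold>D\<close>, and \<open>is_iso (full_sub C S)\<close> demands that the inverse lies in \<open>\<^bold>D\<close>.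
  The values of \<open>\<Sigma>\<close> outside \<open>Obj C\<close>, and of \<open>deg\<close> at arrows whose codomain is not in \<open>S\<close>, are
  irrelevant.
\<close>

locale galois_setting = category C
  for C :: "('o, 'a) cat" (structure) +
  fixes S :: "'o set"
    and \<Sigma> :: "'o \<Rightarrow> 'a set"
    and deg :: "'a \<Rightarrow> nat"
  assumes S_Obj: "S \<subseteq> Obj C"
    and G1: "\<lbrakk>f \<in> Arr (full_sub C S); g \<in> Arr (full_sub C S); Cod C f = Cod C g\<rbrakk>
      \<Longrightarrow> \<exists>p q. is_pullback C f g p q"
    and G2_I: "\<lbrakk>f \<in> Arr (full_sub C S); g \<in> Arr (full_sub C S); Dom C f = Dom C g\<rbrakk>
      \<Longrightarrow> \<exists>p q. is_pushout (full_sub C S) f g p q"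
    and G2_II: "f \<in> Arr (full_sub C S) \<Longrightarrow> epic (full_sub C S) f"
    and G2_III: "monic (full_sub C S) f \<Longrightarrow> is_iso (full_sub C S) f"
    and G3_arr: "\<lbrakk>U \<in> Obj C; i \<in> \<Sigma> U\<rbrakk> \<Longrightarrow> i \<in> Arr C \<and> Dom C i \<in> S \<and> Cod C i = U"
    and G3_ex1: "\<lbrakk>U \<in> Obj C; u \<in> Arr C; Dom C u \<in> S; Cod C u = U\<rbrakk>
      \<Longrightarrow> \<exists>!i. i \<in> \<Sigma> U \<and> Hom C u i \<noteq> {}"
    and G4_pos: "\<lbrakk>f \<in> Arr C; Cod C f \<in> S\<rbrakk> \<Longrightarrow> deg f > 0"
    and G4_I: "\<lbrakk>f \<in> Arr C; g \<in> Arr C; Dom C g = Cod C f; Cod C f \<in> S; Cod C g \<in> S\<rbrakk>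
      \<Longrightarrow> deg (g \<cdot> f) = deg g * deg f"
    and G4_II: "\<lbrakk>f \<in> Arr C; Cod C f \<in> S\<rbrakk>
      \<Longrightarrow> finite (\<Sigma> (Dom C f)) \<and> deg f = (\<Sum>i\<in>\<Sigma> (Dom C f). deg (f \<cdot> i))"
    and G4_III: "\<lbrakk>f \<in> Arr (full_sub C S); g \<in> Arr (full_sub C S); is_pullback C f g p q\<rbrakk>
      \<Longrightarrow> deg f = deg q \<and> deg g = deg p"

definition cover :: "('o, 'a) cat \<Rightarrow> 'o set \<Rightarrow> 'a \<Rightarrow> bool" where
  "cover C S f \<longleftrightarrow> f \<in> Arr (full_sub C S)"

definition Aut :: "('o, 'a) cat \<Rightarrow> 'a \<Rightarrow> 'a set" where
  "Aut C f = {h \<in> Hom C f f. is_iso C h}"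

text \<open>
  Degrees of covers are positive, so \<open>card (Aut C f) = deg f\<close> entails that \<open>Aut C f\<close> is finite.
\<close>

definition galois :: "('o, 'a) cat \<Rightarrow> ('a \<Rightarrow> nat) \<Rightarrow> 'a \<Rightarrow> bool" where
  "galois C deg f \<longleftrightarrow> card (Aut C f) = deg f"

definition below :: "('o, 'a) cat \<Rightarrow> 'a \<Rightarrow> 'a \<Rightarrow> bool"  ("(_ \<sqsubseteq>\<index> _)" [51, 51] 50) where
  "f \<sqsubseteq>\<^bsub>C\<^esub> g \<longleftrightarrow> Cod C f = Cod C g \<and> Hom C g f \<noteq> {}"

definition isomorphic_covers :: "('o, 'a) cat \<Rightarrow> 'a \<Rightarrow> 'a \<Rightarrow> bool" where
  "isomorphic_covers C f g \<longleftrightarrow> f \<sqsubseteq>\<^bsub>C\<^esub> g \<and> g \<sqsubseteq>\<^bsub>C\<^esub> f"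

definition least_cover :: "('o, 'a) cat \<Rightarrow> 'o set \<Rightarrow> ('a \<Rightarrow> bool) \<Rightarrow> 'a \<Rightarrow> bool" where
  "least_cover C S P g \<longleftrightarrow> cover C S g \<and> P g \<and> (\<forall>h. cover C S h \<and> P h \<longrightarrow> g \<sqsubseteq>\<^bsub>C\<^esub> h)"

definition minimal_cover :: "('o, 'a) cat \<Rightarrow> 'o set \<Rightarrow> ('a \<Rightarrow> bool) \<Rightarrow> 'a \<Rightarrow> bool" where
  "minimal_cover C S P g \<longleftrightarrow>
    cover C S g \<and> P g \<and> (\<forall>h. cover C S h \<and> P h \<and> h \<sqsubseteq>\<^bsub>C\<^esub> g \<longrightarrow> g \<sqsubseteq>\<^bsub>C\<^esub> h)"

definition galois_closure ::
    "('o, 'a) cat \<Rightarrow> 'o set \<Rightarrow> ('a \<Rightarrow> nat) \<Rightarrow> 'a \<Rightarrow> 'a \<Rightarrow> bool" where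
  "galois_closure C S deg f g \<longleftrightarrow> minimal_cover C S (\<lambda>h. galois C deg h \<and> f \<sqsubseteq>\<^bsub>C\<^esub> h) g"

end

theory Submission
  imports Defs
begin

text \<open>
  Call \<open>f\<close> split by \<open>g\<close> if \<open>card (Hom C g f) = deg f\<close>. For a pullback \<open>f \<cdot> p = g \<cdot> q\<close> with vertex \<open>U\<close>, the
  set \<open>Hom C g f\<close> corresponds to the components \<open>i \<in> \<Sigma> U\<close> for which \<open>deg (q \<cdot> i) = 1\<close>, so
  \<open>card (Hom C g f) \<le> deg f\<close>, with equality iff every component comes from some \<open>h \<in> Hom C g f\<close>. A
  component that does not come from \<open>Hom C g f\<close> yields a cover \<open>g \<cdot> q \<cdot> i\<close> admitting strictly more
  factorisations through \<open>f\<close>; hence \<open>f\<close> is split by some cover. By a pushout, two covers splitting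
  \<open>f\<close> lie above a third one that splits \<open>f\<close>, so one of minimal degree is a least one. The same
  pushout, applied to the components of the pullback of the least one \<open>g\<close> along itself, shows that \<open>g\<close>
  is split by itself, i.e. Galois. Conversely, a Galois cover splits everything below it, by counting
  fibres. All four conditions thus say that \<open>g\<close> is isomorphic to this least cover.
\<close>

context galois_setting
begin

section \<open>Covers, factorisations and the order between covers\<close>

lemma cover_iff: "cover C S f \<longleftrightarrow> f \<in> Arr C \<and> Dom C f \<in> S \<and> Cod C f \<in> S"
  by (simp add: cover_def full_sub_def)

lemma cover_comp:
  assumes "cover C S f" "cover C S g" "Dom C g = Cod C f"
  shows "cover C S (g \<cdot> f)"
  using assms by (simp add: cover_iff Comp_Arr Dom_Comp Cod_Comp)

lemma cover_ident: "A \<in> S \<Longrightarrow> cover C S (Ident C A)"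
  using S_Obj by (auto simp: cover_iff Ident_Arr Dom_Ident Cod_Ident)

lemma Hom_D:
  assumes "h \<in> Hom C g f" "f \<in> Arr C"
  shows "h \<in> Arr C" "Dom C h = Dom C g" "Cod C h = Dom C f" "f \<cdot> h = g"
  using assms by (auto simp: Hom_def Dom_Comp)

lemma Hom_I:
  assumes "h \<in> Arr C" "Cod C h = Dom C f" "f \<cdot> h = g"
  shows "h \<in> Hom C g f"
  using assms by (auto simp: Hom_def)

lemma cover_Hom:
  assumes "cover C S f" "cover C S g" "h \<in> Hom C g f"
  shows "cover C S h"
  using assms Hom_D[OF assms(3)] by (auto simp: cover_iff)

lemma Ident_in_Hom: "f \<in> Arr C \<Longrightarrow> Ident C (Dom C f) \<in> Hom C f f"
  by (rule Hom_I) (auto simp: Ident_Arr Cod_Ident Comp_Ident Dom_Obj)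

lemma Hom_comp:
  assumes "f \<in> Arr C" "g \<in> Arr C" "a \<in> Hom C g f" "b \<in> Hom C h g"
  shows "a \<cdot> b \<in> Hom C h f"
  using Hom_D[OF assms(3,1)] Hom_D[OF assms(4,2)] assms(1,2)
  by (intro Hom_I) (auto simp: Comp_Arr Cod_Comp Comp_assoc[symmetric])

lemma below_iff: "\<lbrakk>f \<in> Arr C; g \<in> Arr C\<rbrakk> \<Longrightarrow> f \<sqsubseteq> g \<longleftrightarrow> Hom C g f \<noteq> {}"
  by (auto simp: below_def Hom_def Cod_Comp)

lemma below_I:
  assumes "g \<in> Arr C" "h \<in> Arr C" "Cod C h = Dom C g"
  shows "g \<sqsubseteq> g \<cdot> h"
  using assms by (auto simp: below_def Hom_def Cod_Comp)

lemma below_refl: "f \<in> Arr C \<Longrightarrow> f \<sqsubseteq> f"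
  using Ident_in_Hom by (auto simp: below_def)

lemma below_trans:
  assumes "f \<in> Arr C" "g \<in> Arr C" "h \<in> Arr C" "f \<sqsubseteq> g" "g \<sqsubseteq> h"
  shows "f \<sqsubseteq> h"
  using assms Hom_comp by (simp add: below_iff) blast

text \<open>(G2)(II) gives epicness only inside the full subcategory. The condition
  \<open>Cod C y \<in> S\<close>, together with the domains being \<open>Cod C e\<close>, places
  \<open>x\<close> and \<open>y\<close> there.\<close>

lemma cover_cancel:
  assumes "cover C S e" "x \<in> Arr C" "y \<in> Arr C" "Dom C x = Cod C e" "Dom C y = Cod C e"
    and "Cod C x = Cod C y" "Cod C y \<in> S" "x \<cdot> e = y \<cdot> e"
  shows "x = y"
proof -
  have "epic (full_sub C S) e"
    using assms(1) G2_II by (simp add: cover_def)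
  then show ?thesis
    using assms by (auto simp: epic_def full_sub_def cover_iff)
qed

lemma Hom_cancel:
  assumes "cover C S f" "cover C S g" "cover C S t" "Cod C t = Dom C g"
    and "x \<in> Hom C g f" "y \<in> Hom C g f" "x \<cdot> t = y \<cdot> t"
  shows "x = y"
  using assms Hom_D[OF assms(5)] Hom_D[OF assms(6)]
  by (intro cover_cancel[of t x y]) (auto simp: cover_iff)

section \<open>Degrees of covers\<close>

lemma deg_pos: "cover C S f \<Longrightarrow> deg f > 0"
  by (simp add: cover_iff G4_pos)

lemma deg_comp:
  assumes "cover C S f" "cover C S g" "Dom C g = Cod C f"
  shows "deg (g \<cdot> f) = deg g * deg f"
  using assms by (auto simp: cover_iff intro!: G4_I)

text \<open>The identity is idempotent, so its degree is a positive solution of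
  \<open>d = d * d\<close>.\<close>

lemma deg_Ident:
  assumes "A \<in> S"
  shows "deg (Ident C A) = 1"
proof -
  have c: "cover C S (Ident C A)" and A: "A \<in> Obj C"
    using assms cover_ident S_Obj by auto
  then have "Ident C A \<cdot> Ident C A = Ident C A"
    using Comp_Ident[of "Ident C A"] by (simp add: Dom_Ident Ident_Arr)
  then show ?thesis
    using deg_comp[OF c c] deg_pos[OF c] A by (simp add: Dom_Ident Cod_Ident)
qed

lemma deg_eq_1_of_section:
  assumes "cover C S g" "cover C S f" "Dom C g = Cod C f" "g \<cdot> f = Ident C (Dom C f)"
  shows "deg g = 1"
proof -
  have "deg g * deg f = 1"
    using deg_comp[OF assms(2,1,3)] deg_Ident assms(2,4) by (simp add: cover_iff)
  then show ?thesis
    by simp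
qed

section \<open>Components of objects and of pullbacks\<close>

text \<open>The factor \<open>k\<close> runs between objects of \<open>S\<close>, so it is itself a
  cover and can be cancelled.\<close>

lemma Sigma_factor:
  assumes "u \<in> Arr C" "Dom C u \<in> S"
  obtains j k where "j \<in> \<Sigma> (Cod C u)" "k \<in> Hom C u j" "cover C S k"
proof -
  obtain j where j: "j \<in> \<Sigma> (Cod C u)" "Hom C u j \<noteq> {}"
    using G3_ex1[OF _ assms(1,2)] Cod_Obj assms(1) by blast
  then obtain k where k: "k \<in> Hom C u j"
    by blast
  have "j \<in> Arr C" "Dom C j \<in> S"
    using G3_arr[OF Cod_Obj[OF assms(1)] j(1)] by auto
  then have "cover C S k"
    using Hom_D[OF k] assms by (simp add: cover_iff)
  then show thesis
    using that j k by blast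
qed

text \<open>Since \<open>i\<close> also factors through itself by the identity, uniqueness in (G3)
  applies.\<close>

lemma Sigma_unique:
  assumes "U \<in> Obj C" "i \<in> \<Sigma> U" "j \<in> \<Sigma> U" "Hom C i j \<noteq> {}"
  shows "i = j"
proof -
  have i: "i \<in> Arr C" "Dom C i \<in> S" "Cod C i = U"
    using G3_arr assms by auto
  then have "Hom C i i \<noteq> {}"
    using Ident_in_Hom by blast
  then show ?thesis
    using G3_ex1[OF assms(1) i] assms by blast
qed

lemma ex_pullback:
  assumes "cover C S f" "cover C S g" "Cod C f = Cod C g"
  obtains p q where "is_pullback C f g p q"
  using assms G1 unfolding cover_def by blast

lemma is_pullback_D:
  assumes "is_pullback C f g p q"
  shows "f \<in> Arr C" "g \<in> Arr C" "p \<in> Arr C" "q \<in> Arr C" "Cod C f = Cod C g" "Dom C p = Dom C q"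
    "Cod C p = Dom C f" "Cod C q = Dom C g" "f \<cdot> p = g \<cdot> q"
  using assms by (auto simp: is_pullback_def)

lemma is_pullback_univ:
  assumes "is_pullback C f g p q" "x \<in> Arr C" "y \<in> Arr C" "Dom C x = Dom C y"
    "Cod C x = Dom C f" "Cod C y = Dom C g" "f \<cdot> x = g \<cdot> y"
  obtains u where "u \<in> Arr C" "Dom C u = Dom C x" "Cod C u = Dom C q" "p \<cdot> u = x" "q \<cdot> u = y"
proof -
  have "Dom C p = Dom C q"
    using assms(1) by (rule is_pullback_D)
  moreover have "\<exists>!u. u \<in> Arr C \<and> Dom C u = Dom C x \<and> Cod C u = Dom C p \<and> p \<cdot> u = x \<and> q \<cdot> u = y"
    using assms unfolding is_pullback_def by blast
  ultimately show thesis
    using that by auto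
qed

lemma is_pullback_joint_monic:
  assumes "is_pullback C f g p q" "u \<in> Arr C" "v \<in> Arr C" "Dom C u = Dom C v"
    "Cod C u = Dom C q" "Cod C v = Dom C q" "p \<cdot> u = p \<cdot> v" "q \<cdot> u = q \<cdot> v"
  shows "u = v"
proof -
  note pb = is_pullback_D[OF assms(1)]
  have eq: "f \<cdot> (p \<cdot> u) = g \<cdot> (q \<cdot> u)"
    using pb assms by (simp add: Comp_assoc[symmetric])
  have arr: "p \<cdot> u \<in> Arr C" "q \<cdot> u \<in> Arr C" "Dom C (p \<cdot> u) = Dom C (q \<cdot> u)" "Dom C (p \<cdot> u) = Dom C u"
    "Cod C (p \<cdot> u) = Dom C f" "Cod C (q \<cdot> u) = Dom C g"
    using pb assms by (simp_all add: Comp_Arr Dom_Comp Cod_Comp)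
  have "\<exists>!w. w \<in> Arr C \<and> Dom C w = Dom C (p \<cdot> u) \<and> Cod C w = Dom C p \<and> p \<cdot> w = p \<cdot> u \<and> q \<cdot> w = q \<cdot> u"
    using assms(1) arr(1-3,5,6) eq unfolding is_pullback_def by blast
  then show ?thesis
    using assms(2-) arr(4) pb(6) by metis
qed

text \<open>The vertex of a pullback need not lie in \<open>S\<close>, but its components have
  domains in \<open>S\<close>. Composing them with the projections therefore gives covers, to which
  degrees and cancellation apply.\<close>

lemma pullback_component:
  assumes "cover C S f" "cover C S g" "is_pullback C f g p q" "i \<in> \<Sigma> (Dom C q)"
  shows "i \<in> Arr C" "Dom C i \<in> S" "Cod C i = Dom C q" "cover C S (p \<cdot> i)" "cover C S (q \<cdot> i)"
    "Dom C (p \<cdot> i) = Dom C i" "Dom C (q \<cdot> i) = Dom C i"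
    "Cod C (p \<cdot> i) = Dom C f" "Cod C (q \<cdot> i) = Dom C g" "f \<cdot> (p \<cdot> i) = g \<cdot> (q \<cdot> i)"
proof -
  note pb = is_pullback_D[OF assms(3)]
  show i: "i \<in> Arr C" "Dom C i \<in> S" "Cod C i = Dom C q"
    using G3_arr[OF Dom_Obj assms(4)] pb by auto
  show "cover C S (p \<cdot> i)" "cover C S (q \<cdot> i)"
    "Dom C (p \<cdot> i) = Dom C i" "Dom C (q \<cdot> i) = Dom C i"
    "Cod C (p \<cdot> i) = Dom C f" "Cod C (q \<cdot> i) = Dom C g"
    using i pb assms by (auto simp: cover_iff Comp_Arr Dom_Comp Cod_Comp)
  show "f \<cdot> (p \<cdot> i) = g \<cdot> (q \<cdot> i)"
    using i pb by (simp add: Comp_assoc[symmetric])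
qed

text \<open>(G4)(III) replaces \<open>deg f\<close> by \<open>deg q\<close>, which (G4)(II)
  distributes over the components.\<close>

lemma deg_pullback:
  assumes "cover C S f" "cover C S g" "is_pullback C f g p q"
  shows "finite (\<Sigma> (Dom C q))" "deg f = (\<Sum>i\<in>\<Sigma> (Dom C q). deg (q \<cdot> i))"
proof -
  have "q \<in> Arr C" "Cod C q \<in> S"
    using is_pullback_D[OF assms(3)] assms(2) by (auto simp: cover_iff)
  from G4_II[OF this] show "finite (\<Sigma> (Dom C q))" "deg f = (\<Sum>i\<in>\<Sigma> (Dom C q). deg (q \<cdot> i))"
    using G4_III[of f g p q] assms by (auto simp: cover_def)
qed

text \<open>A factorisation \<open>h\<close> is encoded by the component through which the section \<open>(h, 1)\<close> of \<open>q\<close> factors.\<close>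

lemma Hom_section:
  assumes "cover C S f" "cover C S g" "is_pullback C f g p q" "h \<in> Hom C g f"
  obtains s where "s \<in> Arr C" "Dom C s = Dom C g" "Cod C s = Dom C q"
    "p \<cdot> s = h" "q \<cdot> s = Ident C (Dom C g)"
proof -
  have arr: "f \<in> Arr C" "g \<in> Arr C"
    using assms(1,2) by (auto simp: cover_iff)
  note h = Hom_D[OF assms(4) arr(1)]
  have "Dom C g \<in> Obj C"
    using arr Dom_Obj by blast
  with h arr have "Ident C (Dom C g) \<in> Arr C" "Dom C h = Dom C (Ident C (Dom C g))"
    "Cod C (Ident C (Dom C g)) = Dom C g" "f \<cdot> h = g \<cdot> Ident C (Dom C g)"
    by (simp_all add: Ident_Arr Dom_Ident Cod_Ident Comp_Ident)
  then show thesis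
    using is_pullback_univ[OF assms(3) h(1) _ _ h(3), of "Ident C (Dom C g)"] that h(2) by auto
qed

text \<open>Let the section \<open>s\<close> factor as \<open>j \<cdot> k\<close>. Both
  \<open>p \<cdot> j\<close> and \<open>h \<cdot> (q \<cdot> j)\<close> become \<open>h\<close>
  after composition with \<open>k\<close>, and \<open>k\<close> is epic. If \<open>i\<close>
  satisfies the same equation, then \<open>s \<cdot> (q \<cdot> i)\<close> and \<open>i\<close> have
  the same projections, so \<open>i\<close> factors through \<open>j\<close>. The degree is 1
  because \<open>k\<close> is a section of \<open>q \<cdot> j\<close>.\<close>

lemma component_of_Hom:
  assumes "cover C S f" "cover C S g" "is_pullback C f g p q" "h \<in> Hom C g f"
  shows "\<exists>!i. i \<in> \<Sigma> (Dom C q) \<and> p \<cdot> i = h \<cdot> (q \<cdot> i)"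
    and "\<lbrakk>i \<in> \<Sigma> (Dom C q); p \<cdot> i = h \<cdot> (q \<cdot> i)\<rbrakk> \<Longrightarrow> deg (q \<cdot> i) = 1"
proof -
  note pb = is_pullback_D[OF assms(3)]
  note h = Hom_D[OF assms(4) pb(1)]
  obtain s where s: "s \<in> Arr C" "Dom C s = Dom C g" "Cod C s = Dom C q"
    "p \<cdot> s = h" "q \<cdot> s = Ident C (Dom C g)"
    by (rule Hom_section[OF assms])
  have "Dom C s \<in> S"
    using s(2) assms(2) by (simp add: cover_iff)
  then obtain j k where j: "j \<in> \<Sigma> (Dom C q)" and k: "k \<in> Hom C s j" "cover C S k"
    using Sigma_factor[OF s(1)] s(3) by metis
  note jc = pullback_component[OF assms(1-3) j]
  note kD = Hom_D[OF k(1) jc(1)]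
  have qjk: "(q \<cdot> j) \<cdot> k = Ident C (Dom C k)"
    using kD jc pb s by (simp add: Comp_assoc)
  have pjk: "(p \<cdot> j) \<cdot> k = h"
    using kD jc pb s by (simp add: Comp_assoc)
  have "(h \<cdot> (q \<cdot> j)) \<cdot> k = h \<cdot> Ident C (Dom C h)"
    using qjk kD jc h s by (simp add: Comp_assoc cover_iff)
  then have eq: "(p \<cdot> j) \<cdot> k = (h \<cdot> (q \<cdot> j)) \<cdot> k"
    using pjk h(2) Comp_Ident[OF h(1)] by simp
  have "h \<cdot> (q \<cdot> j) \<in> Arr C" "Dom C (h \<cdot> (q \<cdot> j)) = Dom C j" "Cod C (h \<cdot> (q \<cdot> j)) = Dom C f"
    using jc(5,7,9) h(1-3) by (simp_all add: cover_iff Comp_Arr Dom_Comp Cod_Comp)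
  then have pj: "p \<cdot> j = h \<cdot> (q \<cdot> j)"
    using jc(4,6,8) kD(3) assms(1)
    by (intro cover_cancel[OF k(2) _ _ _ _ _ _ eq]) (simp_all add: cover_iff)
  have unique: "i = j" if i: "i \<in> \<Sigma> (Dom C q)" "p \<cdot> i = h \<cdot> (q \<cdot> i)" for i
  proof -
    note ic = pullback_component[OF assms(1-3) i(1)]
    have qi: "q \<cdot> i \<in> Arr C"
      using ic(5) by (simp add: cover_iff)
    have ps: "p \<cdot> (s \<cdot> (q \<cdot> i)) = p \<cdot> i"
      using Comp_assoc[of "q \<cdot> i" s p] i(2) ic(9) pb s qi by simp
    have "q \<cdot> (s \<cdot> (q \<cdot> i)) = Ident C (Dom C g) \<cdot> (q \<cdot> i)"
      using s pb ic qi by (metis Comp_assoc)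
    then have qs: "q \<cdot> (s \<cdot> (q \<cdot> i)) = q \<cdot> i"
      using Ident_Comp[OF qi] ic by simp
    have "s \<cdot> (q \<cdot> i) \<in> Arr C" "Dom C (s \<cdot> (q \<cdot> i)) = Dom C i" "Cod C (s \<cdot> (q \<cdot> i)) = Dom C q"
      using ic(7,9) s(1-3) qi by (simp_all add: Comp_Arr Dom_Comp Cod_Comp)
    then have "s \<cdot> (q \<cdot> i) = i"
      using is_pullback_joint_monic[OF assms(3) _ ic(1) _ _ ic(3) ps qs] by simp
    then have "j \<cdot> (k \<cdot> (q \<cdot> i)) = i"
      using Comp_assoc[of "q \<cdot> i" k j] kD ic(9) jc(1) qi s(2) by simp
    then have "k \<cdot> (q \<cdot> i) \<in> Hom C i j"
      using kD jc ic qi s by (intro Hom_I) (auto simp: Comp_Arr Cod_Comp)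
    then show ?thesis
      using Sigma_unique i j pb(4) Dom_Obj by blast
  qed
  show "\<exists>!i. i \<in> \<Sigma> (Dom C q) \<and> p \<cdot> i = h \<cdot> (q \<cdot> i)"
    using j pj unique by blast
  show "deg (q \<cdot> i) = 1" if "i \<in> \<Sigma> (Dom C q)" "p \<cdot> i = h \<cdot> (q \<cdot> i)"
    using unique[OF that] deg_eq_1_of_section[OF jc(5) k(2) _ qjk] jc kD by simp
qed

section \<open>Counting factorisations\<close>

text \<open>A factorisation is determined by its component, since \<open>q \<cdot> i\<close> is
  epic, and each component adds at least 1 to the sum that equals \<open>deg f\<close>.\<close>

lemma Hom_finite_card_le:
  assumes "cover C S f" "cover C S g"
  shows "finite (Hom C g f)" "card (Hom C g f) \<le> deg f"
proof -
  have "finite (Hom C g f) \<and> card (Hom C g f) \<le> deg f"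
  proof (cases "Hom C g f = {}")
    \<comment> \<open>A factorisation forces equal codomains, as the pullback requires; without one
      the bound is trivial.\<close>
    case False
    then have "Cod C f = Cod C g"
      using assms below_iff[of f g] by (auto simp: cover_iff below_def)
    then obtain p q where pb: "is_pullback C f g p q"
      using ex_pullback assms by blast
    note \<Sigma> = deg_pullback[OF assms pb]
    define c where "c h = (THE i. i \<in> \<Sigma> (Dom C q) \<and> p \<cdot> i = h \<cdot> (q \<cdot> i))" for h
    have c: "c h \<in> \<Sigma> (Dom C q) \<and> p \<cdot> c h = h \<cdot> (q \<cdot> c h)" if "h \<in> Hom C g f" for h
      unfolding c_def by (rule theI', rule component_of_Hom(1)[OF assms pb that])
    have inj: "inj_on c (Hom C g f)"
    proof (rule inj_onI)
      fix x y assume xy: "x \<in> Hom C g f" "y \<in> Hom C g f" "c x = c y"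
      note i = pullback_component[OF assms pb conjunct1[OF c[OF xy(1)]]]
      have "x \<cdot> (q \<cdot> c x) = y \<cdot> (q \<cdot> c x)"
        using c xy by metis
      then show "x = y"
        using Hom_cancel[OF assms i(5,9) xy(1,2)] by blast
    qed
    have "card (\<Sigma> (Dom C q)) = (\<Sum>i\<in>\<Sigma> (Dom C q). 1)"
      by simp
    also have "\<dots> \<le> (\<Sum>i\<in>\<Sigma> (Dom C q). deg (q \<cdot> i))"
      using pullback_component(5)[OF assms pb] deg_pos by (intro sum_mono) (simp add: Suc_leI)
    finally have "card (\<Sigma> (Dom C q)) \<le> deg f"
      using \<Sigma>(2) by simp
    moreover have "c ` Hom C g f \<subseteq> \<Sigma> (Dom C q)"
      using c by blast
    ultimately show ?thesis
      using inj \<Sigma>(1) by (meson card_inj_on_le inj_on_finite le_trans)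
  qed simp
  then show "finite (Hom C g f)" "card (Hom C g f) \<le> deg f"
    by auto
qed

text \<open>All summands of \<open>deg f\<close> are 1 here, so \<open>deg f\<close> counts the
  components. Choosing a factorisation for each is injective, because a factorisation determines its
  component.\<close>

lemma card_Hom_eq_deg:
  assumes "cover C S f" "cover C S g" "is_pullback C f g p q"
    and ex: "\<And>i. i \<in> \<Sigma> (Dom C q) \<Longrightarrow> \<exists>h \<in> Hom C g f. p \<cdot> i = h \<cdot> (q \<cdot> i)"
  shows "card (Hom C g f) = deg f"
proof -
  obtain d where d: "\<And>i. i \<in> \<Sigma> (Dom C q) \<Longrightarrow> d i \<in> Hom C g f \<and> p \<cdot> i = d i \<cdot> (q \<cdot> i)"
    using ex by metis
  then have "deg (q \<cdot> i) = 1" if "i \<in> \<Sigma> (Dom C q)" for i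
    using component_of_Hom(2)[OF assms(1-3)] that by blast
  then have "deg f = card (\<Sigma> (Dom C q))"
    using deg_pullback(2)[OF assms(1-3)] by simp
  moreover have "inj_on d (\<Sigma> (Dom C q))"
    using d component_of_Hom(1)[OF assms(1-3)] by (intro inj_onI) metis
  then have "card (\<Sigma> (Dom C q)) \<le> card (Hom C g f)"
    using d Hom_finite_card_le[OF assms(1,2)] by (intro card_inj_on_le[of d]) auto
  ultimately show ?thesis
    using Hom_finite_card_le[OF assms(1,2)] by simp
qed

text \<open>Since \<open>t\<close> is epic, passing from \<open>g\<close> to the finer cover
  \<open>g \<cdot> t\<close> loses no factorisations.\<close>

lemma card_Hom_comp_le:
  assumes "cover C S f" "cover C S g" "cover C S t" "Cod C t = Dom C g"
  shows "inj_on (\<lambda>h. h \<cdot> t) (Hom C g f)" "(\<lambda>h. h \<cdot> t) ` Hom C g f \<subseteq> Hom C (g \<cdot> t) f"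
    "card (Hom C g f) \<le> card (Hom C (g \<cdot> t) f)"
proof -
  show inj: "inj_on (\<lambda>h. h \<cdot> t) (Hom C g f)"
    using Hom_cancel[OF assms] by (auto intro: inj_onI)
  have "t \<in> Hom C (g \<cdot> t) g"
    using assms by (auto intro: Hom_I simp: cover_iff)
  then show sub: "(\<lambda>h. h \<cdot> t) ` Hom C g f \<subseteq> Hom C (g \<cdot> t) f"
    using Hom_comp[of f g] assms(1,2) by (auto simp: cover_iff)
  have "cover C S (g \<cdot> t)"
    using cover_comp assms by simp
  then show "card (Hom C g f) \<le> card (Hom C (g \<cdot> t) f)"
    using Hom_finite_card_le[OF assms(1)] inj sub by (intro card_inj_on_le)
qed

section \<open>Covers that split \<open>f\<close>\<close>

text \<open>The bound \<open>deg f\<close> allows a choice of \<open>g\<close> with as many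
  factorisations as possible. A component \<open>i\<close> coming from none of them would make
  \<open>p \<cdot> i\<close> an additional factorisation of \<open>g \<cdot> (q \<cdot> i)\<close>,
  against maximality.\<close>

lemma ex_split:
  assumes f: "cover C S f"
  shows "\<exists>g. cover C S g \<and> card (Hom C g f) = deg f"
proof -
  let ?P = "\<lambda>n. \<exists>g. cover C S g \<and> Cod C g = Cod C f \<and> card (Hom C g f) = n"
  have "?P (card (Hom C f f))"
    using f by blast
  moreover have bound: "\<And>n. ?P n \<Longrightarrow> n \<le> deg f"
    using Hom_finite_card_le(2)[OF f] by blast
  ultimately have "?P (GREATEST n. ?P n)"
    by (rule GreatestI_nat)
  then obtain g where g: "cover C S g" "Cod C g = Cod C f"
    and max: "card (Hom C g f) = (GREATEST n. ?P n)"
    by blast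
  obtain p q where pb: "is_pullback C f g p q"
    using ex_pullback[OF f g(1)] g(2) by auto
  have "\<exists>h \<in> Hom C g f. p \<cdot> i = h \<cdot> (q \<cdot> i)" if i: "i \<in> \<Sigma> (Dom C q)" for i
  proof (rule ccontr)
    assume none: "\<not> ?thesis"
    note ic = pullback_component[OF f g(1) pb i]
    let ?g' = "g \<cdot> (q \<cdot> i)" and ?r = "\<lambda>h. h \<cdot> (q \<cdot> i)"
    note comp = card_Hom_comp_le[OF f g(1) ic(5,9)]
    have g': "cover C S ?g'" "Cod C ?g' = Cod C f"
      using cover_comp[OF ic(5) g(1)] ic g by (auto simp: cover_iff Cod_Comp)
    have "p \<cdot> i \<in> Hom C ?g' f"
      using ic by (intro Hom_I) (auto simp: cover_iff)
    then have "insert (p \<cdot> i) (?r ` Hom C g f) \<subseteq> Hom C ?g' f"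
      using comp(2) by blast
    then have "card (insert (p \<cdot> i) (?r ` Hom C g f)) \<le> card (Hom C ?g' f)"
      using Hom_finite_card_le(1)[OF f g'(1)] card_mono by blast
    moreover have "p \<cdot> i \<notin> ?r ` Hom C g f"
      using none by blast
    ultimately have "card (Hom C g f) < card (Hom C ?g' f)"
      using Hom_finite_card_le(1)[OF f g(1)] by (simp add: card_image[OF comp(1)])
    moreover have "card (Hom C ?g' f) \<le> (GREATEST n. ?P n)"
      using g' bound by (intro Greatest_le_nat[of ?P _ "deg f"]) auto
    ultimately show False
      using max by simp
  qed
  then show ?thesis
    using card_Hom_eq_deg[OF f g(1) pb] g(1) by blast
qed

text \<open>The number of factorisations cannot drop from \<open>g\<close> to \<open>h\<close>, and
  it is already at its upper bound.\<close>

lemma split_mono: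
  assumes "cover C S f" "cover C S g" "cover C S h" "g \<sqsubseteq> h" "card (Hom C g f) = deg f"
  shows "card (Hom C h f) = deg f"
proof -
  obtain t where t: "t \<in> Hom C h g"
    using assms(4) by (auto simp: below_def)
  have "g \<in> Arr C"
    using assms(2) by (simp add: cover_iff)
  note tD = Hom_D[OF t this]
  have "card (Hom C g f) \<le> card (Hom C h f)"
    using card_Hom_comp_le(3)[OF assms(1,2) cover_Hom[OF assms(2,3) t] tD(3)] tD(4) by simp
  then show ?thesis
    using assms Hom_finite_card_le(2)[OF assms(1,3)] by simp
qed

text \<open>Composition with \<open>r\<close>, where \<open>f = e \<cdot> r\<close>, maps \<open>Hom C g f\<close> to \<open>Hom C g e\<close>; the fibre over \<open>k\<close> is \<open>Hom C k r\<close>.\<close>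

lemma split_antimono:
  assumes "cover C S e" "cover C S f" "cover C S g" "e \<sqsubseteq> f" "card (Hom C g f) = deg f"
  shows "card (Hom C g e) = deg e"
proof -
  obtain r where r: "r \<in> Hom C f e"
    using assms(4) by (auto simp: below_def)
  have arr: "e \<in> Arr C" "f \<in> Arr C"
    using assms(1,2) by (auto simp: cover_iff)
  note rD = Hom_D[OF r arr(1)]
  have rc: "cover C S r"
    by (rule cover_Hom[OF assms(1,2) r])
  note kc = cover_Hom[OF assms(1,3)]
  have sub: "Hom C g f \<subseteq> (\<Union>k\<in>Hom C g e. Hom C k r)"
  proof
    fix h assume h: "h \<in> Hom C g f"
    have "r \<cdot> h \<in> Hom C g e"
      by (rule Hom_comp[OF arr r h])
    moreover have "h \<in> Hom C (r \<cdot> h) r"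
      using Hom_D[OF h arr(2)] rD by (intro Hom_I) auto
    ultimately show "h \<in> (\<Union>k\<in>Hom C g e. Hom C k r)"
      by blast
  qed
  have fin: "finite (\<Union>k\<in>Hom C g e. Hom C k r)"
    using Hom_finite_card_le(1)[OF assms(1,3)] Hom_finite_card_le(1)[OF rc kc] by blast
  have "deg e * deg r = card (Hom C g f)"
    using deg_comp[OF rc assms(1)] rD assms(5) by simp
  also have "\<dots> \<le> card (\<Union>k\<in>Hom C g e. Hom C k r)"
    by (rule card_mono[OF fin sub])
  also have "\<dots> \<le> (\<Sum>k\<in>Hom C g e. card (Hom C k r))"
    by (rule card_UN_le, rule Hom_finite_card_le(1)[OF assms(1,3)])
  also have "\<dots> \<le> (\<Sum>k\<in>Hom C g e. deg r)"
    using Hom_finite_card_le(2)[OF rc kc] by (intro sum_mono)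
  finally have "deg e \<le> card (Hom C g e)"
    using deg_pos[OF rc] by simp
  then show ?thesis
    using Hom_finite_card_le(2)[OF assms(1,3)] by simp
qed

text \<open>Every factorisation of \<open>g \<cdot> t\<close> through \<open>f\<close> extends both
  to one of \<open>g\<close> and to one of \<open>g'\<close>, because the counts are already
  maximal. Such a pair glues along the pushout to a factorisation of \<open>m\<close>, so
  \<open>m\<close> has as many as \<open>g\<close>.\<close>

lemma split_pushout:
  assumes f: "cover C S f" and g: "cover C S g" "cover C S g'"
    and t: "cover C S t" "cover C S t'" "Cod C t = Dom C g" "Cod C t' = Dom C g'"
    and eq: "g \<cdot> t = g' \<cdot> t'"
    and split: "card (Hom C g f) = deg f" "card (Hom C g' f) = deg f"
  obtains m u v where "cover C S m" "u \<in> Hom C g m" "v \<in> Hom C g' m" "u \<cdot> t = v \<cdot> t'"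
    "card (Hom C m f) = deg f"
proof -
  let ?D = "full_sub C S"
  have D: "Arr ?D = {x. cover C S x}" "Dom ?D = Dom C" "Cod ?D = Cod C" "Comp ?D = Comp C"
    by (auto simp: full_sub_def cover_iff)
  have arr: "f \<in> Arr C" "g \<in> Arr C" "g' \<in> Arr C" "t \<in> Arr C" "t' \<in> Arr C"
    using f g t by (auto simp: cover_iff)
  have "Dom C (g \<cdot> t) = Dom C t" "Dom C (g' \<cdot> t') = Dom C t'"
    using arr t(3,4) by (simp_all add: Dom_Comp)
  then have dom: "Dom C t = Dom C t'"
    using eq by simp
  have "Cod C (g \<cdot> t) = Cod C g" "Cod C (g' \<cdot> t') = Cod C g'"
    using arr t(3,4) by (simp_all add: Cod_Comp)
  then have cod: "Cod C g = Cod C g'"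
    using eq by simp
  obtain u v where po: "is_pushout ?D t t' u v"
    using G2_I[of t t'] t dom by (auto simp: cover_def)
  then have u: "cover C S u" "Dom C u = Dom C g" "cover C S v" "Dom C v = Dom C g'" "Cod C u = Cod C v"
      "u \<cdot> t = v \<cdot> t'"
    using t by (auto simp: is_pushout_def D)
  \<comment> \<open>The pushout lives in the full subcategory, so its mediating arrows are covers
    and exist for pairs of covers.\<close>
  have univ: "\<exists>w. cover C S w \<and> Dom C w = Cod C u \<and> Cod C w = Cod C x \<and> w \<cdot> u = x \<and> w \<cdot> v = y"
    if "cover C S x" "cover C S y" "Cod C x = Cod C y" "Dom C x = Dom C g" "Dom C y = Dom C g'"
      "x \<cdot> t = y \<cdot> t'" for x y
  proof -
    have "\<exists>!w. w \<in> Arr ?D \<and> Dom ?D w = Cod ?D u \<and> Cod ?D w = Cod ?D x \<and> Comp ?D w u = x \<and> Comp ?D w v = y"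
      if "x \<in> Arr ?D" "y \<in> Arr ?D"
        "Cod ?D x = Cod ?D y \<and> Dom ?D x = Cod ?D t \<and> Dom ?D y = Cod ?D t' \<and> Comp ?D x t = Comp ?D y t'"
      using po that unfolding is_pushout_def by blast
    then have "\<exists>!w. cover C S w \<and> Dom C w = Cod C u \<and> Cod C w = Cod C x \<and> w \<cdot> u = x \<and> w \<cdot> v = y"
      using that t(3,4) by (simp add: D)
    then show ?thesis
      by blast
  qed
  obtain m where m: "cover C S m" "Dom C m = Cod C u" "Cod C m = Cod C g" "m \<cdot> u = g" "m \<cdot> v = g'"
    using univ[OF g(1,2) cod refl refl eq] by blast
  have uv: "u \<in> Hom C g m" "v \<in> Hom C g' m"
    using u m by (auto intro!: Hom_I simp: cover_iff)
  let ?k = "g \<cdot> t"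
  have k: "cover C S ?k"
    using cover_comp[OF t(1) g(1)] t by simp
  note fin = Hom_finite_card_le[OF f k]
  \<comment> \<open>The map is injective and \<open>Hom C g f\<close> has \<open>deg f\<close>
    elements, the most that \<open>Hom C ?k f\<close> can have.\<close>
  have onto: "(\<lambda>h. h \<cdot> t) ` Hom C g f = Hom C ?k f"
    using card_Hom_comp_le[OF f g(1) t(1,3)] split(1) fin
    by (intro card_seteq) (simp_all add: card_image)
  have onto': "(\<lambda>h. h \<cdot> t') ` Hom C g' f = Hom C ?k f"
    using card_Hom_comp_le[OF f g(2) t(2,4)] split(2) fin unfolding eq
    by (intro card_seteq) (simp_all add: card_image)
  have "Hom C ?k f \<subseteq> (\<lambda>l. l \<cdot> (u \<cdot> t)) ` Hom C m f"
  proof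
    fix h assume h: "h \<in> Hom C ?k f"
    obtain x where x: "x \<in> Hom C g f" "h = x \<cdot> t"
      using h onto by blast
    obtain y where y: "y \<in> Hom C g' f" "h = y \<cdot> t'"
      using h onto' by blast
    note xD = Hom_D[OF x(1) arr(1)] and yD = Hom_D[OF y(1) arr(1)]
    obtain l where l: "cover C S l" "Dom C l = Cod C u" "Cod C l = Dom C f" "l \<cdot> u = x"
      using univ[OF cover_Hom[OF f g(1) x(1)] cover_Hom[OF f g(2) y(1)]] xD yD x y by auto
    have lD: "l \<in> Arr C" "u \<in> Arr C" "m \<in> Arr C"
      using l u m by (auto simp: cover_iff)
    have "Cod C f = Cod C g"
      using xD arr by (auto simp: Cod_Comp)
    \<comment> \<open>Both sides equal \<open>g\<close>; cancelling \<open>u\<close> shows that the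
      glued arrow \<open>l\<close> factors \<open>m\<close>.\<close>
    moreover have eq_u: "(f \<cdot> l) \<cdot> u = m \<cdot> u"
      using lD l arr xD m by (simp add: Comp_assoc)
    moreover have "f \<cdot> l \<in> Arr C" "Dom C (f \<cdot> l) = Cod C u" "Cod C (f \<cdot> l) = Cod C f"
      using lD(1) l(2,3) arr(1) by (simp_all add: Comp_Arr Dom_Comp Cod_Comp)
    ultimately have "f \<cdot> l = m"
      using cover_cancel[OF u(1) _ lD(3) _ m(2) _ _ eq_u] m(1,3) by (simp add: cover_iff)
    then have "l \<in> Hom C m f"
      using l lD by (intro Hom_I) auto
    moreover have "h = l \<cdot> (u \<cdot> t)"
      using Comp_assoc[of t u l] x(2) l(2,4) lD(1,2) u(2) t(3) arr(4) by simp
    ultimately show "h \<in> (\<lambda>l. l \<cdot> (u \<cdot> t)) ` Hom C m f"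
      by blast
  qed
  then have "card (Hom C ?k f) \<le> card (Hom C m f)"
    by (rule surj_card_le[OF Hom_finite_card_le(1)[OF f m(1)]])
  moreover have "card (Hom C g f) \<le> card (Hom C ?k f)"
    by (rule card_Hom_comp_le(3)[OF f g(1) t(1,3)])
  ultimately have "card (Hom C m f) = deg f"
    using split Hom_finite_card_le(2)[OF f m(1)] by simp
  then show thesis
    using that m(1) uv u(6) by blast
qed

section \<open>Common covers, degree one and the least splitting cover\<close>

text \<open>The degrees over the components sum to \<open>deg f > 0\<close>, so the pullback has at
  least one component.\<close>

lemma ex_common_cover:
  assumes "cover C S f" "cover C S g" "Cod C f = Cod C g"
  obtains s t where "cover C S s" "cover C S t" "Cod C s = Dom C f" "Cod C t = Dom C g"
    "f \<cdot> s = g \<cdot> t"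
proof -
  obtain p q where pb: "is_pullback C f g p q"
    by (rule ex_pullback[OF assms])
  have "\<Sigma> (Dom C q) \<noteq> {}"
    using deg_pullback(2)[OF assms(1,2) pb] deg_pos[OF assms(1)] by auto
  then obtain i where "i \<in> \<Sigma> (Dom C q)"
    by blast
  note ic = pullback_component[OF assms(1,2) pb this]
  show thesis
    by (rule that[OF ic(4,5,8,9,10)])
qed

text \<open>Degree 1 leaves room for only one component of the pullback of \<open>e\<close> along
  itself: the one coming from the identity, on which the two projections agree. Any
  \<open>x\<close>, \<open>y\<close> with \<open>e \<cdot> x = e \<cdot> y\<close> pass through it,
  so \<open>e\<close> is monic and (G2)(III) applies.\<close>

lemma deg_1_iso:
  assumes e: "cover C S e" "deg e = 1"
  shows "is_iso (full_sub C S) e"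
proof (rule G2_III)
  obtain p q where pb: "is_pullback C e e p q"
    by (rule ex_pullback[OF e(1) e(1) refl])
  note \<Sigma> = deg_pullback[OF e(1) e(1) pb]
  note pbD = is_pullback_D[OF pb]
  have arr: "e \<in> Arr C"
    using e by (simp add: cover_iff)
  note idH = Ident_in_Hom[OF arr]
  obtain i where i: "i \<in> \<Sigma> (Dom C q)" "p \<cdot> i = Ident C (Dom C e) \<cdot> (q \<cdot> i)"
    using component_of_Hom(1)[OF e(1) e(1) pb idH] by blast
  note ic = pullback_component[OF e(1) e(1) pb i(1)]
  have pq: "p \<cdot> i = q \<cdot> i"
    using i(2) Ident_Comp[of "q \<cdot> i"] ic by (simp add: cover_iff)
  have single: "j = i" if j: "j \<in> \<Sigma> (Dom C q)" for j
  proof (rule ccontr)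
    assume "j \<noteq> i"
    then have "(\<Sum>k\<in>{i, j}. deg (q \<cdot> k)) \<le> deg e"
      unfolding \<Sigma>(2) using \<Sigma>(1) i(1) j by (intro sum_mono2) auto
    moreover have "deg (q \<cdot> i) > 0" "deg (q \<cdot> j) > 0"
      using deg_pos pullback_component(5)[OF e(1) e(1) pb] i j by auto
    ultimately show False
      using \<open>j \<noteq> i\<close> e(2) by simp
  qed
  have "x = y" if x: "cover C S x" and y: "cover C S y"
    and xy: "Cod C x = Dom C e" "Cod C y = Dom C e" "Dom C x = Dom C y" "e \<cdot> x = e \<cdot> y" for x y
  proof -
    have "x \<in> Arr C" "y \<in> Arr C"
      using x y by (auto simp: cover_iff)
    then obtain w where w: "w \<in> Arr C" "Dom C w = Dom C x" "Cod C w = Dom C q" "p \<cdot> w = x" "q \<cdot> w = y"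
      by (rule is_pullback_univ[OF pb _ _ xy(3,1,2,4)])
    have "Dom C w \<in> S"
      using w x by (simp add: cover_iff)
    then obtain k where k: "k \<in> Hom C w i"
      using Sigma_factor[OF w(1)] w(3) single by metis
    note kD = Hom_D[OF k ic(1)]
    have "x = (p \<cdot> i) \<cdot> k" "y = (q \<cdot> i) \<cdot> k"
      using w kD ic pbD by (simp_all add: Comp_assoc)
    then show ?thesis
      using pq by simp
  qed
  then show "monic (full_sub C S) e"
    using e(1) by (auto simp: monic_def full_sub_def cover_iff)
qed

lemma below_of_deg_1:
  assumes m: "cover C S m" and u: "cover C S u" "Cod C u = Dom C m" "deg u = 1"
  shows "m \<cdot> u \<sqsubseteq> m"
proof -
  obtain w where w: "w \<in> Arr C" "Dom C w = Cod C u" "Cod C w = Dom C u" "u \<cdot> w = Ident C (Cod C u)"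
    using deg_1_iso[OF u(1,3)] by (auto simp: is_iso_def full_sub_def)
  have arr: "m \<in> Arr C" "u \<in> Arr C"
    using m u by (auto simp: cover_iff)
  have "(m \<cdot> u) \<cdot> w = m"
    using w arr u(2) by (simp add: Comp_assoc Comp_Ident)
  moreover have "m \<cdot> u \<sqsubseteq> (m \<cdot> u) \<cdot> w"
    using w arr u(2) by (intro below_I) (auto simp: Comp_Arr Dom_Comp)
  ultimately show ?thesis
    by simp
qed

lemma split_below:
  assumes "cover C S f" "cover C S g" "card (Hom C g f) = deg f"
  shows "f \<sqsubseteq> g"
proof -
  have "Hom C g f \<noteq> {}"
    using deg_pos[OF assms(1)] assms(3) by auto
  then show ?thesis
    using below_iff assms(1,2) by (simp add: cover_iff)
qed

text \<open>Let \<open>g\<close> split \<open>f\<close> with minimal degree. For any other splitting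
  \<open>h\<close>, a common cover and a pushout give a splitting \<open>m\<close> below both.
  Writing \<open>g = m \<cdot> u\<close>, minimality forces \<open>deg u = 1\<close>, so
  \<open>g \<sqsubseteq> m \<sqsubseteq> h\<close>.\<close>

lemma ex_least_split:
  assumes f: "cover C S f"
  shows "\<exists>g. least_cover C S (\<lambda>h. card (Hom C h f) = deg f) g"
proof -
  let ?P = "\<lambda>g. cover C S g \<and> card (Hom C g f) = deg f"
  obtain g where g: "?P g" and min: "\<And>h. ?P h \<Longrightarrow> deg g \<le> deg h"
    using ex_split[OF f] ex_has_least_nat[of ?P _ deg] by blast
  have "g \<sqsubseteq> h" if h: "?P h" for h
  proof -
    have cod: "Cod C g = Cod C h"
      using split_below[OF f, of g] split_below[OF f, of h] g h by (simp add: below_def)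
    obtain s t where st: "cover C S s" "cover C S t" "Cod C s = Dom C g" "Cod C t = Dom C h"
      "g \<cdot> s = h \<cdot> t"
      using ex_common_cover[of g h] g h cod by blast
    obtain m u v where m: "cover C S m" "u \<in> Hom C g m" "v \<in> Hom C h m" "card (Hom C m f) = deg f"
      using split_pushout[OF f _ _ st] g h by blast
    have arr: "m \<in> Arr C" "g \<in> Arr C" "h \<in> Arr C"
      using m(1) g h by (auto simp: cover_iff)
    note uD = Hom_D[OF m(2) arr(1)]
    have u: "cover C S u"
      using cover_Hom m g by blast
    have "deg g = deg m * deg u"
      using deg_comp[OF u m(1)] uD by simp
    moreover have "deg g \<le> deg m" "deg m > 0" "deg u > 0"
      using min m deg_pos u by auto
    ultimately have "deg u = 1"
      by (metis le_antisym mult.right_neutral mult_le_cancel1 Suc_leI One_nat_def)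
    then have "g \<sqsubseteq> m"
      using below_of_deg_1[OF m(1) u] uD by simp
    moreover have "m \<sqsubseteq> h"
      using m(3) below_iff arr by blast
    ultimately show ?thesis
      using below_trans arr by blast
  qed
  then show ?thesis
    using g by (auto simp: least_cover_def)
qed

section \<open>Automorphisms and Galois covers\<close>

text \<open>
  Since covers are epic, composition on the right with \<open>a\<close> is an injective, hence surjective, map on
  the finite set \<open>Hom C g g\<close>.
\<close>

lemma Hom_left_inverse:
  assumes g: "cover C S g" and a: "a \<in> Hom C g g"
  obtains b where "b \<in> Hom C g g" "b \<cdot> a = Ident C (Dom C g)"
proof -
  have arr: "g \<in> Arr C"
    using g by (simp add: cover_iff)
  note aD = Hom_D[OF a arr]
  note comp = card_Hom_comp_le[OF g g cover_Hom[OF g g a] aD(3)]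
  have "(\<lambda>h. h \<cdot> a) ` Hom C g g = Hom C g g"
    using endo_inj_surj[OF Hom_finite_card_le(1)[OF g g] _ comp(1)] comp(2) aD(4) by simp
  then obtain b where "b \<in> Hom C g g" "Ident C (Dom C g) = b \<cdot> a"
    using Ident_in_Hom[OF arr] by blast
  then show thesis
    using that by simp
qed

text \<open>A left inverse \<open>b\<close> of \<open>a\<close> has a left inverse \<open>c\<close>
  in turn, and then \<open>c = c \<cdot> (b \<cdot> a) = (c \<cdot> b) \<cdot> a = a\<close>. Being
  Galois thus means being split by itself.\<close>

lemma Aut_eq_Hom:
  assumes g: "cover C S g"
  shows "Aut C g = Hom C g g"
proof -
  have arr: "g \<in> Arr C"
    using g by (simp add: cover_iff)
  have "is_iso C a" if a: "a \<in> Hom C g g" for a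
  proof -
    obtain b where b: "b \<in> Hom C g g" "b \<cdot> a = Ident C (Dom C g)"
      by (rule Hom_left_inverse[OF g a])
    obtain c where c: "c \<in> Hom C g g" "c \<cdot> b = Ident C (Dom C g)"
      by (rule Hom_left_inverse[OF g b(1)])
    note aD = Hom_D[OF a arr] and bD = Hom_D[OF b(1) arr] and cD = Hom_D[OF c(1) arr]
    have "c = c \<cdot> (b \<cdot> a)"
      using b cD Comp_Ident[of c] by simp
    also have "\<dots> = (c \<cdot> b) \<cdot> a"
      using aD bD cD by (simp add: Comp_assoc)
    also have "\<dots> = a"
      using c aD Ident_Comp[of a] by simp
    finally show ?thesis
      using aD bD b c by (auto simp: is_iso_def)
  qed
  then show ?thesis
    by (auto simp: Aut_def)
qed

lemma galois_iff: "cover C S g \<Longrightarrow> galois C deg g \<longleftrightarrow> card (Hom C g g) = deg g"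
  by (simp add: galois_def Aut_eq_Hom)

text \<open>It suffices that each component of the pullback of \<open>g\<close> along itself comes
  from some \<open>a\<close>. The pushout of \<open>p \<cdot> i\<close> and
  \<open>q \<cdot> i\<close> yields a splitting \<open>m\<close> below \<open>g\<close>, and
  leastness gives \<open>g \<sqsubseteq> m\<close>. The resulting \<open>w\<close> turns
  \<open>u\<close> and \<open>v\<close> into endomorphisms of \<open>g\<close>.\<close>

lemma least_split_galois:
  assumes f: "cover C S f" and least: "least_cover C S (\<lambda>h. card (Hom C h f) = deg f) g"
  shows "galois C deg g"
proof -
  have g: "cover C S g" "card (Hom C g f) = deg f"
    using least by (auto simp: least_cover_def)
  have arr: "g \<in> Arr C"
    using g by (simp add: cover_iff)
  obtain p q where pb: "is_pullback C g g p q"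
    by (rule ex_pullback[OF g(1) g(1) refl])
  have "\<exists>a \<in> Hom C g g. p \<cdot> i = a \<cdot> (q \<cdot> i)" if i: "i \<in> \<Sigma> (Dom C q)" for i
  proof -
    note ic = pullback_component[OF g(1) g(1) pb i]
    obtain m u v where m: "cover C S m" "u \<in> Hom C g m" "v \<in> Hom C g m"
      "u \<cdot> (p \<cdot> i) = v \<cdot> (q \<cdot> i)" "card (Hom C m f) = deg f"
      using split_pushout[OF f g(1) g(1) ic(4,5,8,9,10) g(2) g(2)] by blast
    have marr: "m \<in> Arr C"
      using m(1) by (simp add: cover_iff)
    have "g \<sqsubseteq> m"
      using least m by (auto simp: least_cover_def)
    then obtain w where w: "w \<in> Hom C m g"
      by (auto simp: below_def)
    have wu: "w \<cdot> u \<in> Hom C g g" and wv: "w \<cdot> v \<in> Hom C g g"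
      using Hom_comp[OF arr marr w] m by auto
    obtain b where b: "b \<in> Hom C g g" "b \<cdot> (w \<cdot> u) = Ident C (Dom C g)"
      by (rule Hom_left_inverse[OF g(1) wu])
    \<comment> \<open>Inverting \<open>w \<cdot> u\<close> in \<open>w \<cdot> u \<cdot> (p \<cdot>
      i) = w \<cdot> v \<cdot> (q \<cdot> i)\<close> produces this witness.\<close>
    have a: "b \<cdot> (w \<cdot> v) \<in> Hom C g g"
      by (rule Hom_comp[OF arr arr b(1) wv])
    note bD = Hom_D[OF b(1) arr] and wD = Hom_D[OF w arr]
      and uD = Hom_D[OF m(2) marr] and vD = Hom_D[OF m(3) marr]
    have pi: "p \<cdot> i \<in> Arr C" "q \<cdot> i \<in> Arr C"
      using ic by (auto simp: cover_iff)
    have "p \<cdot> i = (b \<cdot> (w \<cdot> u)) \<cdot> (p \<cdot> i)"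
      using Ident_Comp[OF pi(1)] ic b by simp
    also have "\<dots> = b \<cdot> (w \<cdot> (u \<cdot> (p \<cdot> i)))"
      using bD wD uD pi ic(8) by (simp add: Comp_assoc Comp_Arr Dom_Comp Cod_Comp)
    also have "\<dots> = b \<cdot> (w \<cdot> (v \<cdot> (q \<cdot> i)))"
      using m(4) by simp
    also have "\<dots> = (b \<cdot> (w \<cdot> v)) \<cdot> (q \<cdot> i)"
      using bD wD vD pi ic(9) by (simp add: Comp_assoc Comp_Arr Dom_Comp Cod_Comp)
    finally show ?thesis
      using a by blast
  qed
  then have "card (Hom C g g) = deg g"
    by (rule card_Hom_eq_deg[OF g(1) g(1) pb])
  then show ?thesis
    using galois_iff g(1) by blast
qed

section \<open>Least and minimal covers, and invariance under isomorphism\<close>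

text \<open>A minimal \<open>g\<close> lies above \<open>g\<^sub>0\<close>, hence also below it.
  Conversely, a cover isomorphic to \<open>g\<^sub>0\<close> inherits \<open>P\<close> by
  \<open>inv\<close> and leastness by transitivity.\<close>

lemma least_minimal_iff_isomorphic:
  assumes least: "least_cover C S P g\<^sub>0"
    and inv: "\<And>g. \<lbrakk>cover C S g; isomorphic_covers C g g\<^sub>0\<rbrakk> \<Longrightarrow> P g"
  shows "least_cover C S P g \<longleftrightarrow> cover C S g \<and> isomorphic_covers C g g\<^sub>0"
    and "minimal_cover C S P g \<longleftrightarrow> cover C S g \<and> isomorphic_covers C g g\<^sub>0"
proof -
  have g\<^sub>0: "cover C S g\<^sub>0" "P g\<^sub>0" and le: "\<And>h. \<lbrakk>cover C S h; P h\<rbrakk> \<Longrightarrow> g\<^sub>0 \<sqsubseteq> h"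
    using least by (auto simp: least_cover_def)
  have "least_cover C S P g" if "cover C S g" "isomorphic_covers C g g\<^sub>0"
    using that inv le below_trans g\<^sub>0(1) unfolding least_cover_def isomorphic_covers_def cover_iff
    by blast
  moreover have "minimal_cover C S P g" if "least_cover C S P g"
    using that by (auto simp: least_cover_def minimal_cover_def)
  moreover have "cover C S g \<and> isomorphic_covers C g g\<^sub>0" if "minimal_cover C S P g"
    using that g\<^sub>0 le by (auto simp: minimal_cover_def isomorphic_covers_def)
  ultimately show "least_cover C S P g \<longleftrightarrow> cover C S g \<and> isomorphic_covers C g g\<^sub>0"
    and "minimal_cover C S P g \<longleftrightarrow> cover C S g \<and> isomorphic_covers C g g\<^sub>0"
    by blast+
qed

text \<open>A Galois cover splits itself, and splitting passes down to every cover below.\<close>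

lemma galois_split:
  assumes "cover C S f" "cover C S g" "galois C deg g" "f \<sqsubseteq> g"
  shows "card (Hom C g f) = deg f"
  using assms split_antimono[of f g g] galois_iff by blast

text \<open>The Galois cover \<open>g'\<close> splits \<open>g\<close> because
  \<open>g \<sqsubseteq> g'\<close>; since also \<open>g' \<sqsubseteq> g\<close>, the cover
  \<open>g\<close> splits itself.\<close>

lemma galois_isomorphic:
  assumes g: "cover C S g" "cover C S g'" and iso: "isomorphic_covers C g g'" and "galois C deg g'"
  shows "galois C deg g"
proof -
  have "card (Hom C g' g) = deg g"
    using galois_split assms by (auto simp: isomorphic_covers_def)
  then have "card (Hom C g g) = deg g"
    using split_mono[OF g(1) g(2) g(1)] iso by (simp add: isomorphic_covers_def)
  then show ?thesis
    using galois_iff g(1) by blast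
qed

end

theorem theorem4p7:
  fixes C :: "('o, 'a) cat"
    and S :: "'o set"
    and \<Sigma> :: "'o \<Rightarrow> 'a set"
    and deg :: "'a \<Rightarrow> nat"
    and f :: 'a
  assumes "galois_setting C S \<Sigma> deg"
    and "cover C S f"
  shows "(\<exists>g. galois_closure C S deg f g) \<and>
    (\<forall>g g'. galois_closure C S deg f g \<and> galois_closure C S deg f g' \<longrightarrow> isomorphic_covers C g g') \<and>
    (\<forall>g. cover C S g \<longrightarrow>
      (galois_closure C S deg f g \<longleftrightarrow> least_cover C S (\<lambda>h. galois C deg h \<and> f \<sqsubseteq>\<^bsub>C\<^esub> h) g) \<and>
      (galois_closure C S deg f g \<longleftrightarrow> least_cover C S (\<lambda>h. card (Hom C h f) = deg f) g) \<and>
      (galois_closure C S deg f g \<longleftrightarrow> minimal_cover C S (\<lambda>h. card (Hom C h f) = deg f) g))"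
proof -
  interpret galois_setting C S \<Sigma> deg
    by (rule assms(1))
  note f = assms(2)
  let ?P = "\<lambda>h. card (Hom C h f) = deg f" and ?Q = "\<lambda>h. galois C deg h \<and> f \<sqsubseteq>\<^bsub>C\<^esub> h"
  obtain g\<^sub>0 where P: "least_cover C S ?P g\<^sub>0"
    using ex_least_split[OF f] by blast
  then have g\<^sub>0: "cover C S g\<^sub>0" "?P g\<^sub>0" "?Q g\<^sub>0"
    using least_split_galois[OF f] split_below[OF f] by (auto simp: least_cover_def)
  \<comment> \<open>Every Galois cover above \<open>f\<close> splits \<open>f\<close>, so leastness
    for \<open>?P\<close> carries over to \<open>?Q\<close>.\<close>
  have Q: "least_cover C S ?Q g\<^sub>0"
    using P g\<^sub>0 galois_split[OF f] by (auto simp: least_cover_def)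
  have invP: "?P g" if "cover C S g" "isomorphic_covers C g g\<^sub>0" for g
    using that split_mono[OF f g\<^sub>0(1)] g\<^sub>0(2) by (simp add: isomorphic_covers_def)
  have invQ: "?Q g" if "cover C S g" "isomorphic_covers C g g\<^sub>0" for g
    using that galois_isomorphic g\<^sub>0(1,3) split_below[OF f] invP by blast
  \<comment> \<open>This one isomorphism class describes all four conditions.\<close>
  let ?iso = "\<lambda>g. cover C S g \<and> isomorphic_covers C g g\<^sub>0"
  have P_iff: "least_cover C S ?P g \<longleftrightarrow> ?iso g" "minimal_cover C S ?P g \<longleftrightarrow> ?iso g" for g
    by (rule least_minimal_iff_isomorphic[OF P], rule invP, assumption+)+
  have Q_iff: "least_cover C S ?Q g \<longleftrightarrow> ?iso g" "minimal_cover C S ?Q g \<longleftrightarrow> ?iso g" for g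
    by (rule least_minimal_iff_isomorphic[OF Q], rule invQ, assumption+)+
  have iso: "isomorphic_covers C g g'"
    if "?iso g" "?iso g'" for g g'
    using that below_trans g\<^sub>0(1) unfolding isomorphic_covers_def cover_iff by blast
  have "?iso g\<^sub>0"
    using g\<^sub>0(1) below_refl by (simp add: isomorphic_covers_def cover_iff)
  then show ?thesis
    unfolding galois_closure_def P_iff Q_iff using iso by (intro conjI) blast+
qed

end
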